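(* Let $\alpha,\beta\in\mathbb{C}$ and let $(P_n(x))_{n\ge 0}$ be the family of (Laurent biorthogonal) polynomials defined by $P_0(x)=1$, $P_1(x)=x-(\alpha+\beta)$ and $$P_n(x)=(x-\alpha)P_{n-1}(x)-\beta x P_{n-2}(x),\qquad n\ge 2.$$ Then the coefficient array of the polynomials $P_n(x)$ is the Riordan array $$\left(\frac{1-\beta x}{1+\alpha x},\ \frac{x(1-\beta x)}{1+\alpha x}\right).$$
   Context: For formal power series $g(x)=1+g_1x+g_2x^2+\cdots$ and $f(x)=x+f_2x^2+\cdots$, the Riordan array $(g,f)$ is the infinite lower-triangular matrix with rows and columns indexed by $0,1,2,\ldots$ whose $(n,k)$ entry is $[x^n]\,g(x)f(x)^k$, where $[x^n]$ denotes extraction of the coefficient of $x^n$. The coefficient array of a sequence of polynomials $P_n(x)=\sum_{k=0}^n d_{n,k}x^k$ (with $\deg P_n\le n$) is the infinite lower-triangular matrix $(d_{n,k})_{n,k\ge 0}$. *)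

theory Defs
  imports
    Complex_Main
    "HOL-Computational_Algebra.Polynomial"
    "HOL-Computational_Algebra.Formal_Power_Series"
begin

text \<open>
  Infinite matrices with rows and columns indexed by \<open>0, 1, 2, \<dots>\<close> are functions
  \<open>nat \<Rightarrow> nat \<Rightarrow> 'a\<close>, row index first.
\<close>

definition riordan_pair :: "'a::comm_ring_1 fps \<Rightarrow> 'a fps \<Rightarrow> bool" where
  "riordan_pair g f \<longleftrightarrow> fps_nth g 0 = 1 \<and> fps_nth f 0 = 0 \<and> fps_nth f 1 = 1"

text \<open>Lower triangular whenever \<open>riordan_pair g f\<close> holds.\<close>

definition riordan_array :: "'a::comm_ring_1 fps \<Rightarrow> 'a fps \<Rightarrow> nat \<Rightarrow> nat \<Rightarrow> 'a" where
  "riordan_array g f n k = fps_nth (g * f ^ k) n"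

text \<open>
  Meant for sequences with \<open>degree (P n) \<le> n\<close>; the entries above the diagonal are then zero.
\<close>

definition coeff_array :: "(nat \<Rightarrow> 'a::zero poly) \<Rightarrow> nat \<Rightarrow> nat \<Rightarrow> 'a" where
  "coeff_array P n k = coeff (P n) k"

end

theory Submission
  imports Defs
begin

text \<open>
  The proof is best read column by column. A Riordan array has an intrinsic description: its
  column generating functions form a geometric progression with first term \<open>g\<close> and ratio \<open>f\<close>.
  Let \<open>A\<^sub>k(t) = \<Sum>\<^sub>n [x\<^sup>k] P\<^sub>n(x) t\<^sup>n\<close> be the generating function of column \<open>k\<close> of the
  coefficient array. In the recurrence, multiplication by \<open>x\<close> shifts the column and lowering \<open>n\<close>
  multiplies by \<open>t\<close>; so comparing coefficients of \<open>x\<^sup>0\<close> and of \<open>x\<^bsup>k+1\<^esup>\<close> gives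
  \<open>(1 + \<alpha>t) A\<^sub>0 = 1 - \<beta>t\<close> and \<open>(1 + \<alpha>t) A\<^bsub>k+1\<^esub> = t (1 - \<beta>t) A\<^sub>k\<close>,
  the initial polynomials \<open>P\<^sub>0\<close> and \<open>P\<^sub>1\<close> being just what makes these hold at \<open>t\<^sup>0\<close> and \<open>t\<^sup>1\<close>.
  Since \<open>1 + \<alpha>t\<close> is a unit, this says \<open>A\<^sub>0 = g\<close> and \<open>A\<^bsub>k+1\<^esub> = f A\<^sub>k\<close>
  (\<open>coeff_array_eq_riordan_array\<close>). The degree bound is then the triangularity of the Riordan
  array, which holds because \<open>f\<^sup>k\<close> is divisible by \<open>t\<^sup>k\<close>.
\<close>

lemma fps_eq_divide_unit_iff:
  fixes a b u :: "'a::field fps"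
  assumes "fps_nth u 0 \<noteq> 0"
  shows "a = b / u \<longleftrightarrow> u * a = b"
  using assms by (auto simp: fps_divide_unit inverse_mult_eq_1' mult.left_commute)

lemma riordan_array_above_diagonal:
  assumes "riordan_pair g f" and "n < k"
  shows "riordan_array g f n k = 0"
proof -
  have "fps_nth (f ^ k) j = 0" if "j < k" for j
    using that assms(1) startsby_zero_power_prefix[of f k] by (simp add: riordan_pair_def)
  then show ?thesis
    using assms(2) by (simp add: riordan_array_def fps_mult_nth)
qed

text \<open>
  The intrinsic description of a Riordan array by its columns: it reduces an identity of
  two-dimensional arrays to a first-order recurrence between power series in one variable.
\<close>

lemma coeff_array_eq_riordan_array:
  fixes P :: "nat \<Rightarrow> 'a::comm_ring_1 poly"
  assumes col_0: "Abs_fps (\<lambda>n. coeff (P n) 0) = g"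
    and col_Suc: "\<And>k. Abs_fps (\<lambda>n. coeff (P n) (Suc k)) = f * Abs_fps (\<lambda>n. coeff (P n) k)"
  shows "coeff_array P = riordan_array g f"
proof (intro ext)
  fix n k
  have "Abs_fps (\<lambda>n. coeff (P n) k) = g * f ^ k"
    by (induction k) (simp_all add: col_0 col_Suc mult_ac)
  then show "coeff_array P n k = riordan_array g f n k"
    by (metis coeff_array_def fps_nth_Abs_fps riordan_array_def)
qed

theorem proposition2:
  fixes \<alpha> \<beta> :: complex and P :: "nat \<Rightarrow> complex poly" and g f :: "complex fps"
  assumes P_0: "P 0 = 1"
    and P_1: "P 1 = [:0, 1:] - [:\<alpha> + \<beta>:]"
    and P_rec: "\<And>n. n \<ge> 2 \<Longrightarrow>
      P n = ([:0, 1:] - [:\<alpha>:]) * P (n - 1) - [:\<beta>:] * [:0, 1:] * P (n - 2)"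
  defines "g \<equiv> (1 - fps_const \<beta> * fps_X) / (1 + fps_const \<alpha> * fps_X)"
    and "f \<equiv> (fps_X * (1 - fps_const \<beta> * fps_X)) / (1 + fps_const \<alpha> * fps_X)"
  shows "riordan_pair g f \<and> (\<forall>n. degree (P n) \<le> n) \<and> coeff_array P = riordan_array g f"
proof -
  define u where "u = 1 + fps_const \<alpha> * fps_X"
  define v where "v = 1 - fps_const \<beta> * fps_X"
  define A where "A k = Abs_fps (\<lambda>n. coeff (P n) k)" for k
  have u0: "fps_nth u 0 \<noteq> 0"
    by (simp add: u_def)
  have g: "g = v / u" and f: "f = fps_X * v / u"
    by (simp_all add: g_def f_def u_def v_def)
  have f_eq: "f = fps_X * g"
    using u0 by (simp add: f g fps_divide_unit mult.assoc)
  have "fps_nth g 0 = 1"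
    using u0 by (simp add: g fps_divide_unit u_def v_def)
  then have pair: "riordan_pair g f"
    by (simp add: riordan_pair_def f_eq)

  have rec_0: "coeff (P (Suc (Suc n))) 0 = - \<alpha> * coeff (P (Suc n)) 0" for n
    by (simp add: P_rec[of "Suc (Suc n)"] algebra_simps)
  have rec_Suc: "coeff (P (Suc (Suc n))) (Suc k) =
      coeff (P (Suc n)) k - \<alpha> * coeff (P (Suc n)) (Suc k) - \<beta> * coeff (P n) k" for n k
    by (simp add: P_rec[of "Suc (Suc n)"] algebra_simps)
  have P_Suc_0: "P (Suc 0) = [:- (\<alpha> + \<beta>), 1:]"
    using P_1 by simp

  have "u * A 0 = v"
  proof (rule fps_ext)
    fix n
    consider "n = 0" | "n = 1" | m where "n = Suc (Suc m)"
      by (metis One_nat_def not0_implies_Suc)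
    then show "fps_nth (u * A 0) n = fps_nth v n"
      by cases (simp_all add: u_def v_def A_def P_0 P_Suc_0 rec_0 distrib_right mult.assoc)
  qed
  then have col_0: "A 0 = g"
    using u0 by (simp add: g fps_eq_divide_unit_iff)

  have "u * A (Suc k) = fps_X * v * A k" for k
  proof (rule fps_ext)
    fix n
    consider "n = 0" | "n = 1" | m where "n = Suc (Suc m)"
      by (metis One_nat_def not0_implies_Suc)
    then show "fps_nth (u * A (Suc k)) n = fps_nth (fps_X * v * A k) n"
      by cases (simp_all add: u_def v_def A_def P_0 P_Suc_0 rec_Suc distrib_right
          left_diff_distrib mult.assoc coeff_pCons split: nat.split)
  qed
  then have "A (Suc k) = fps_X * v * A k / u" for k
    using u0 by (simp add: fps_eq_divide_unit_iff)
  then have col_Suc: "A (Suc k) = f * A k" for k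
    using u0 by (simp add: f fps_divide_unit mult_ac)

  have array: "coeff_array P = riordan_array g f"
    using col_0 col_Suc unfolding A_def by (rule coeff_array_eq_riordan_array)
  have "degree (P n) \<le> n" for n
    using riordan_array_above_diagonal[OF pair] array
    by (intro degree_le) (metis coeff_array_def)
  with pair array show ?thesis
    by blast
qed

end
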